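(* Let $\{P_\theta\}_{\theta\in\Theta}$ be a family of probability measures on a measurable space $(\Omega,\mathcal{F})$, where $\Theta$ is partitioned into $\Theta_0$ (null) and $\Theta_1$ (alternative). Let $S$ be a sufficient statistic for $\Theta$. Let $E$ be an e-variable for $\Theta_0$ and set $G=\mathbb{E}_\Theta[E\mid S]$. Then $G$ is an e-variable for $\Theta_0$, and for any concave utility function $f$ and any $\theta\in\Theta$, $$\mathbb{E}_\theta[f(G)]\ \ge\ \mathbb{E}_\theta[f(E)],$$ assuming both sides of this inequality are well-defined.
   Context: Random variables are measurable functions on $\Omega$ with values in $[-\infty,\infty]$. The expectation $\mathbb{E}[Y]$ is well-defined (as an element of $[-\infty,\infty]$) if $\mathbb{E}[Y^+]$ or $\mathbb{E}[Y^-]$ is finite, where $y^+=\max(0,y)$, $y^-=\max(0,-y)$; then $\mathbb{E}[Y]=\mathbb{E}[Y^+]-\mathbb{E}[Y^-]$, and generalized conditional expectations $\mathbb{E}[Y\mid\mathcal{G}]=\mathbb{E}[Y^+\mid\mathcal{G}]-\mathbb{E}[Y^-\mid\mathcal{G}]$ exist. $\mathbb{E}_\theta$ denotes expectation under $P_\theta$. An e-variable for $\Theta_0$ is a $[0,\infty]$-valued random variable $E$ with $\mathbb{E}_\theta[E]\le 1$ for all $\theta\in\Theta_0$. A measurable function $S$ on $\Omega$ (with values in a measurable space) is a sufficient statistic for $\Theta$ if for every random variable $h$ on $\Omega$ there is a measurable function $g_h$ such that $\mathbb{E}_\theta[h\mid S]=g_h(S)$ $P_\theta$-a.s. for all $\theta\in\Theta$,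 whenever these conditional expectations exist (in particular whenever $h\ge 0$). Conditioning on $S$ means conditioning on $\sigma(S)$. The common version $g_h(S)$ is denoted $\mathbb{E}_\Theta[h\mid S]$. A concave utility function is a concave function $f:(0,\infty)\to\mathbb{R}$, extended to $f:[0,\infty]\to[-\infty,\infty]$ by $f(0):=\lim_{x\downarrow 0}f(x)$ and $f(\infty):=\lim_{x\to\infty}f(x)$. *)

theory Defs
  imports "HOL-Probability.Probability"
begin

(* E[Y^+] and E[Y^-] of an extended-real random variable Y; e2ennreal sends negative values to 0. *)

definition expectation_pos :: "'a measure \<Rightarrow> ('a \<Rightarrow> ereal) \<Rightarrow> ennreal" where
  "expectation_pos M Y = (\<integral>\<^sup>+ x. e2ennreal (Y x) \<partial>M)"

definition expectation_neg :: "'a measure \<Rightarrow> ('a \<Rightarrow> ereal) \<Rightarrow> ennreal" where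
  "expectation_neg M Y = (\<integral>\<^sup>+ x. e2ennreal (- Y x) \<partial>M)"

definition expectation_well_defined :: "'a measure \<Rightarrow> ('a \<Rightarrow> ereal) \<Rightarrow> bool" where
  "expectation_well_defined M Y \<longleftrightarrow> expectation_pos M Y < \<infinity> \<or> expectation_neg M Y < \<infinity>"

definition ext_expectation :: "'a measure \<Rightarrow> ('a \<Rightarrow> ereal) \<Rightarrow> ereal" where
  "ext_expectation M Y = enn2ereal (expectation_pos M Y) - enn2ereal (expectation_neg M Y)"

(* The generalized conditional expectation of Y given the sub-sigma-algebra F. It is meaningful
   when expectation_well_defined M Y holds: then one of the two terms is almost surely finite. *)

definition ext_cond_exp :: "'a measure \<Rightarrow> 'a measure \<Rightarrow> ('a \<Rightarrow> ereal) \<Rightarrow> 'a \<Rightarrow> ereal" where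
  "ext_cond_exp M F Y x =
     enn2ereal (nn_cond_exp M F (\<lambda>y. e2ennreal (Y y)) x)
     - enn2ereal (nn_cond_exp M F (\<lambda>y. e2ennreal (- Y y)) x)"

(* M carries only the sigma-algebra of the sample space (its measure is irrelevant); the
   probability measures of the model are P \<theta>. *)

definition statistical_model :: "'a measure \<Rightarrow> ('i \<Rightarrow> 'a measure) \<Rightarrow> 'i set \<Rightarrow> bool" where
  "statistical_model M P \<Theta> \<longleftrightarrow> (\<forall>\<theta>\<in>\<Theta>. prob_space (P \<theta>) \<and> sets (P \<theta>) = sets M)"

definition e_variable :: "'a measure \<Rightarrow> ('i \<Rightarrow> 'a measure) \<Rightarrow> 'i set \<Rightarrow> ('a \<Rightarrow> ennreal) \<Rightarrow> bool" where
  "e_variable M P \<Theta>0 E \<longleftrightarrow>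
     E \<in> borel_measurable M \<and> (\<forall>\<theta>\<in>\<Theta>0. (\<integral>\<^sup>+ x. E x \<partial>P \<theta>) \<le> 1)"

(* H = g(S), with g measurable, is a version of E_\<theta>[h | S] simultaneously for all \<theta> in \<Theta> for which
   this conditional expectation exists. *)

definition common_cond_exp ::
  "'a measure \<Rightarrow> ('i \<Rightarrow> 'a measure) \<Rightarrow> 'i set \<Rightarrow> 'b measure \<Rightarrow> ('a \<Rightarrow> 'b)
     \<Rightarrow> ('a \<Rightarrow> ereal) \<Rightarrow> ('a \<Rightarrow> ereal) \<Rightarrow> bool" where
  "common_cond_exp M P \<Theta> N S h H \<longleftrightarrow>
     (\<exists>g \<in> borel_measurable N.
        (\<forall>x\<in>space M. H x = g (S x)) \<and>
        (\<forall>\<theta>\<in>\<Theta>. expectation_well_defined (P \<theta>) h \<longrightarrow>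
           (AE x in P \<theta>. ext_cond_exp (P \<theta>) (vimage_algebra (space M) S N) h x = g (S x))))"

definition sufficient_statistic ::
  "'a measure \<Rightarrow> ('i \<Rightarrow> 'a measure) \<Rightarrow> 'i set \<Rightarrow> 'b measure \<Rightarrow> ('a \<Rightarrow> 'b) \<Rightarrow> bool" where
  "sufficient_statistic M P \<Theta> N S \<longleftrightarrow>
     S \<in> measurable M N \<and>
     (\<forall>h \<in> borel_measurable M. \<exists>H. common_cond_exp M P \<Theta> N S h H)"

(* A concave utility function is a real function concave on {0<..}; its values outside {0<..} are
   never used. Concave functions are eventually monotone at both ends, so the limits exist. *)

definition utility_ext :: "(real \<Rightarrow> real) \<Rightarrow> ennreal \<Rightarrow> ereal" where
  "utility_ext f y =
     (if y = 0 then Lim (at_right 0) (\<lambda>x. ereal (f x))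
      else if y = \<infinity> then Lim at_top (\<lambda>x. ereal (f x))
      else ereal (f (enn2real y)))"

end

theory Submission
  imports Defs
begin

text \<open>
  The statement is a conditional Jensen inequality for \<open>f\<close> with values and arguments in the extended
  reals. Everything is written as an inequality between sums of positive and negative parts in
  \<^typ>\<open>ennreal\<close>, which holds without any integrability assumption. On \<open>{0 < G < \<infinity>}\<close> one takes the
  conditional expectation of the supergradient inequality \<open>f E \<le> f G + s G * (E - G)\<close> and cancels
  the finite terms \<open>s G * G\<close>. On \<open>{G = 0}\<close> also \<open>E = 0\<close> almost surely. On \<open>{G = \<infinity>}\<close> either \<open>f\<close> is
  nondecreasing and \<open>f \<infinity>\<close> is its supremum, or \<open>f\<close> lies below an affine function of negative slope,
  and then the conditional expectation of the negative part of \<open>f E\<close> is infinite. Only after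
  integration is well-definedness needed, to pass from sums to differences.
\<close>

section \<open>Supergradients and boundary limits of concave functions\<close>

text \<open>The right derivative of \<open>f\<close> serves as \<open>s\<close>: minus the infimum
  \<open>k\<close> of the right difference quotients of the convex function \<open>- f\<close>. A
  Borel choice of slope is required because \<open>s\<close> is later composed with a conditional
  expectation; monotonicity of \<open>k\<close> supplies it.\<close>

lemma concave_measurable_supergradient:
  fixes f :: "real \<Rightarrow> real"
  assumes "concave_on {0<..} f"
  obtains s where "s \<in> borel_measurable borel"
    and "\<And>x y. 0 < x \<Longrightarrow> 0 < y \<Longrightarrow> f x \<le> f y + s y * (x - y)"
proof -
  have conv: "convex_on {0<..} (\<lambda>x. - f x)"
    using assms by (simp add: concave_on_def)
  define k where "k y = Inf ((\<lambda>t. (- f y - - f t) / (y - t)) ` ({y<..} \<inter> {0<..}))" for y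
  define s where "s y = (if y \<in> {0<..} then - k y else 0)" for y
  have grad: "f x \<le> f y + s y * (x - y)" if "0 < x" "0 < y" for x y
    using convex_le_Inf_differential[OF conv, of y x] that
    by (simp add: s_def k_def interior_open)
  have "mono_on {0<..} k"
  proof (rule mono_onI)
    fix x y :: real assume xy: "x \<in> {0<..}" "y \<in> {0<..}" "x \<le> y"
    show "k x \<le> k y"
    proof (cases "x = y")
      case False
      \<comment> \<open>This is the sum of the supergradient inequalities based at \<open>x\<close>
        and at \<open>y\<close>.\<close>
      then have "0 \<le> (k y - k x) * (y - x)"
        using grad[of x y] grad[of y x] xy by (simp add: s_def algebra_simps)
      then show ?thesis
        using False xy by (simp add: zero_le_mult_iff)
    qed simp
  qed
  then have "(\<lambda>y. - k y) \<in> borel_measurable (restrict_space borel {0<..})"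
    by (intro borel_measurable_uminus borel_measurable_mono_on_fnc)
  then have "s \<in> borel_measurable borel"
    unfolding s_def by (subst measurable_If_restrict_space_iff) (auto simp: greaterThan_def)
  then show thesis
    using grad by (rule that)
qed

text \<open>A nonnegative slope at some \<open>y\<close> makes \<open>f\<close> nondecreasing on
  \<open>{0<..y}\<close>, so the limit is the infimum there. If all slopes are negative,
  \<open>f\<close> is nonincreasing and the limit is its supremum.\<close>

lemma concave_tendsto_at_right_0:
  fixes f :: "real \<Rightarrow> real"
  assumes grad: "\<And>x y. 0 < x \<Longrightarrow> 0 < y \<Longrightarrow> f x \<le> f y + s y * (x - y)"
  shows "\<exists>l. ((\<lambda>x. ereal (f x)) \<longlongrightarrow> l) (at_right 0)"
proof (cases "\<exists>y>0. 0 \<le> s y")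
  case True
  then obtain y where y: "0 < y" "0 \<le> s y" by blast
  have mono: "f u \<le> f v" if "0 < u" "u \<le> v" "v \<le> y" for u v
  proof (cases "v = y")
    case True
    have "s y * (u - y) \<le> 0" using that y True by (simp add: mult_nonneg_nonpos)
    then show ?thesis using grad[OF \<open>0 < u\<close> y(1)] True by simp
  next
    case False
    then have v: "0 < v" "v < y" using that by auto
    \<comment> \<open>The slope at \<open>y\<close> gives \<open>f v \<le> f y\<close>; the
      inequality based at \<open>v\<close> then forces \<open>0 \<le> s v\<close>.\<close>
    have "s y * (v - y) \<le> 0" using v y by (simp add: mult_nonneg_nonpos)
    then have "0 \<le> s v * (y - v)" using grad[OF y(1) v(1)] grad[OF v(1) y(1)] by linarith
    then have "0 \<le> s v" using v by (simp add: zero_le_mult_iff)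
    then have "s v * (u - v) \<le> 0" using that by (simp add: mult_nonneg_nonpos)
    then show ?thesis using grad[OF \<open>0 < u\<close> v(1)] by linarith
  qed
  have "((\<lambda>x. ereal (f x)) \<longlongrightarrow> (INF x\<in>{0<..y}. ereal (f x))) (at_right 0)"
  proof (rule decreasing_tendsto)
    show "\<forall>\<^sub>F x in at_right 0. (INF x\<in>{0<..y}. ereal (f x)) \<le> ereal (f x)"
      using eventually_at_right_less[of 0] eventually_at_right_real[OF y(1)]
      by eventually_elim (auto intro: INF_lower)
    fix l assume "(INF x\<in>{0<..y}. ereal (f x)) < l"
    then obtain z where z: "0 < z" "z \<le> y" "ereal (f z) < l" by (auto simp: INF_less_iff)
    show "\<forall>\<^sub>F x in at_right 0. ereal (f x) < l"
      using eventually_at_right_real[OF z(1)]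
    proof eventually_elim
      case (elim x)
      then have "ereal (f x) \<le> ereal (f z)" using mono[of x z] z by simp
      then show ?case using z(3) by (rule le_less_trans)
    qed
  qed
  then show ?thesis ..
next
  case False
  have mono: "f v \<le> f u" if "0 < u" "u \<le> v" for u v
  proof -
    have "s u * (v - u) \<le> 0" using that False by (auto simp: mult_le_0_iff not_le)
    then show ?thesis using grad[of v u] that by simp
  qed
  have "((\<lambda>x. ereal (f x)) \<longlongrightarrow> (SUP x\<in>{0<..}. ereal (f x))) (at_right 0)"
  proof (rule increasing_tendsto)
    show "\<forall>\<^sub>F x in at_right 0. ereal (f x) \<le> (SUP x\<in>{0<..}. ereal (f x))"
      using eventually_at_right_less[of 0] by eventually_elim (auto intro: SUP_upper)
    fix l assume "l < (SUP x\<in>{0<..}. ereal (f x))"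
    then obtain z where z: "0 < z" "l < ereal (f z)" by (auto simp: less_SUP_iff)
    show "\<forall>\<^sub>F x in at_right 0. l < ereal (f x)"
      using eventually_at_right_real[OF z(1)]
    proof eventually_elim
      case (elim x)
      then have "ereal (f z) \<le> ereal (f x)" using mono[of x z] by simp
      with z(2) show ?case by (rule less_le_trans)
    qed
  qed
  then show ?thesis ..
qed

lemma concave_tendsto_MInfty_at_top:
  fixes f :: "real \<Rightarrow> real"
  assumes grad: "\<And>x. 0 < x \<Longrightarrow> f x \<le> f y + c * (x - y)" and "c < 0"
  shows "((\<lambda>x. ereal (f x)) \<longlongrightarrow> -\<infinity>) at_top"
proof -
  have "filterlim (\<lambda>x. (f y - c * y) + c * x) at_bot at_top"
    using \<open>c < 0\<close> by (subst filterlim_tendsto_add_at_bot_iff[OF tendsto_const])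
      (intro filterlim_tendsto_neg_mult_at_bot[OF tendsto_const] filterlim_ident)
  then have bound: "\<forall>\<^sub>F x in at_top. (f y - c * y) + c * x < r" for r
    by (simp add: filterlim_at_bot_dense)
  show ?thesis
    unfolding tendsto_MInfty
  proof
    fix r
    show "\<forall>\<^sub>F x in at_top. ereal (f x) < ereal r"
      using bound[of r] eventually_gt_at_top[of 0]
    proof eventually_elim
      case (elim x)
      then show ?case using grad[of x] by (simp add: algebra_simps)
    qed
  qed
qed

lemma mono_tendsto_SUP_at_top:
  fixes f :: "real \<Rightarrow> real"
  assumes mono: "\<And>u v. 0 < u \<Longrightarrow> u \<le> v \<Longrightarrow> f u \<le> f v"
  shows "((\<lambda>x. ereal (f x)) \<longlongrightarrow> (SUP x\<in>{0<..}. ereal (f x))) at_top"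
proof (rule increasing_tendsto)
  show "\<forall>\<^sub>F x in at_top. ereal (f x) \<le> (SUP x\<in>{0<..}. ereal (f x))"
    using eventually_gt_at_top[of 0] by eventually_elim (auto intro: SUP_upper)
  fix l assume "l < (SUP x\<in>{0<..}. ereal (f x))"
  then obtain z where z: "0 < z" "l < ereal (f z)" by (auto simp: less_SUP_iff)
  show "\<forall>\<^sub>F x in at_top. l < ereal (f x)"
    using eventually_ge_at_top[of z]
  proof eventually_elim
    case (elim x)
    then have "ereal (f z) \<le> ereal (f x)" using mono[of z x] z by simp
    with z(2) show ?case by (rule less_le_trans)
  qed
qed

lemma supergradient_nonneg_imp_mono:
  fixes f :: "real \<Rightarrow> real"
  assumes grad: "\<And>x y. 0 < x \<Longrightarrow> 0 < y \<Longrightarrow> f x \<le> f y + s y * (x - y)"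
    and "\<And>y. 0 < y \<Longrightarrow> 0 \<le> s y" and "0 < u" "u \<le> v"
  shows "f u \<le> f v"
proof -
  have "s v * (u - v) \<le> 0" using assms by (simp add: mult_nonneg_nonpos)
  then show ?thesis using grad[of u v] \<open>0 < u\<close> \<open>u \<le> v\<close> by simp
qed

section \<open>The utility function on the extended half-line\<close>

text \<open>\<open>Lim\<close> has the intended value only once convergence is known, so existence
  of the limit is what makes the definition of \<open>utility_ext\<close> usable at an
  endpoint.\<close>

lemma tendsto_utility_ext_0:
  assumes grad: "\<And>x y. 0 < x \<Longrightarrow> 0 < y \<Longrightarrow> f x \<le> f y + s y * (x - y)"
  shows "((\<lambda>x. ereal (f x)) \<longlongrightarrow> utility_ext f 0) (at_right 0)"
proof -
  obtain l where "((\<lambda>x. ereal (f x)) \<longlongrightarrow> l) (at_right 0)"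
    using concave_tendsto_at_right_0[of f s] grad by blast
  then show ?thesis
    by (simp add: utility_ext_def tendsto_Lim)
qed

lemma tendsto_utility_ext_top:
  assumes grad: "\<And>x y. 0 < x \<Longrightarrow> 0 < y \<Longrightarrow> f x \<le> f y + s y * (x - y)"
  shows "((\<lambda>x. ereal (f x)) \<longlongrightarrow> utility_ext f \<infinity>) at_top"
proof -
  obtain l where "((\<lambda>x. ereal (f x)) \<longlongrightarrow> l) at_top"
  proof (cases "\<exists>y>0. s y < 0")
    case True
    then obtain y where "0 < y" "s y < 0" by blast
    then show ?thesis
      using concave_tendsto_MInfty_at_top[of f y "s y"] grad that by blast
  next
    case False
    then show ?thesis
      using that mono_tendsto_SUP_at_top[of f] supergradient_nonneg_imp_mono[of f s] grad
      by (metis not_le)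
  qed
  then show ?thesis
    by (simp add: utility_ext_def tendsto_Lim)
qed

text \<open>At \<open>e = 0\<close> the inequality passes to the limit. At
  \<open>e = \<infinity>\<close> the sign of the slope decides: a positive one makes the right-hand
  side infinite, a zero one bounds \<open>f\<close> by \<open>f y\<close> throughout, and a negative
  one drives \<open>f\<close> to -\<infinity>.\<close>

lemma utility_ext_le_supergradient:
  assumes grad: "\<And>x y. 0 < x \<Longrightarrow> 0 < y \<Longrightarrow> f x \<le> f y + s y * (x - y)" and y: "0 < y"
  shows "utility_ext f e \<le> ereal (f y) + ereal (s y) * (enn2ereal e - ereal y)"
proof -
  consider "e = 0" | "e = \<infinity>" | r where "0 < r" "e = ennreal r"
    by (metis ennreal_cases ennreal_0 infinity_ennreal_def order_le_less)
  then show ?thesis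
  proof cases
    case 1
    have lim: "((\<lambda>x. ereal (f y + s y * (x - y))) \<longlongrightarrow> ereal (f y + s y * (0 - y))) (at_right 0)"
      by (intro tendsto_intros)
    have "utility_ext f 0 \<le> ereal (f y + s y * (0 - y))"
      by (rule tendsto_le[OF _ lim tendsto_utility_ext_0[OF grad]])
        (auto intro!: eventually_mono[OF eventually_at_right_less[of 0]] grad y)
    then show ?thesis
      by (simp add: 1 zero_ennreal.rep_eq)
  next
    case 2
    \<comment> \<open>For \<open>s y = 0\<close> the right-hand side is \<open>f y\<close>, since \<open>0 * \<infinity> = 0\<close> in \<^typ>\<open>ereal\<close>.\<close>
    consider "0 < s y" | "s y = 0" | "s y < 0" by linarith
    then show ?thesis
    proof cases
      case 1
      then show ?thesis by (simp add: 2)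
    next
      case 2
      then have "utility_ext f \<infinity> \<le> ereal (f y)"
        by (intro tendsto_upperbound[OF tendsto_utility_ext_top[OF grad]])
          (auto intro!: eventually_mono[OF eventually_gt_at_top[of 0]] order_trans[OF grad] y)
      then show ?thesis by (simp add: \<open>e = \<infinity>\<close> 2 flip: zero_ereal_def)
    next
      case 3
      then have "utility_ext f \<infinity> = -\<infinity>"
        using tendsto_unique[OF _ tendsto_utility_ext_top[OF grad]
            concave_tendsto_MInfty_at_top[of f y "s y"]] grad y by auto
      then show ?thesis by (simp add: 2)
    qed
  next
    case 3
    then show ?thesis
      using grad[of r y] y by (simp add: utility_ext_def enn2ereal_ennreal)
  qed
qed

lemma utility_ext_mono_le_top:
  assumes grad: "\<And>x y. 0 < x \<Longrightarrow> 0 < y \<Longrightarrow> f x \<le> f y + s y * (x - y)"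
    and nonneg: "\<And>y. 0 < y \<Longrightarrow> 0 \<le> s y"
  shows "utility_ext f e \<le> utility_ext f \<infinity>"
proof -
  note mono = supergradient_nonneg_imp_mono[of f s, OF grad nonneg]
  have real: "ereal (f r) \<le> utility_ext f \<infinity>" if "0 < r" for r
    by (rule tendsto_lowerbound[OF tendsto_utility_ext_top[OF grad]])
      (auto intro!: eventually_mono[OF eventually_ge_at_top[of r]] mono that)
  consider "e = 0" | "e = \<infinity>" | r where "0 < r" "e = ennreal r"
    by (metis ennreal_cases ennreal_0 infinity_ennreal_def order_le_less)
  then show ?thesis
  proof cases
    case 1
    have "utility_ext f 0 \<le> utility_ext f \<infinity>"
      by (rule tendsto_upperbound[OF tendsto_utility_ext_0[OF grad]])
        (auto intro!: eventually_mono[OF eventually_at_right_less[of 0]] real[simplified])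
    then show ?thesis by (simp add: 1)
  next
    case 3
    then show ?thesis using real[of r] by (simp add: utility_ext_def)
  qed simp
qed

lemma borel_measurable_utility_ext:
  assumes "concave_on {0<..} f"
  shows "utility_ext f \<in> borel_measurable borel"
proof -
  have "continuous_on {0<..} (\<lambda>x. - (- f x))"
    using assms unfolding concave_on_def
    by (intro continuous_intros convex_on_continuous) auto
  \<comment> \<open>Off \<open>{0<..}\<close> the function \<open>f\<close> is arbitrary and may
    fail to be Borel, so it is replaced by 0 there.\<close>
  then have "(\<lambda>x. if x \<in> {0<..} then f x else 0) \<in> borel_measurable borel"
    by (intro borel_measurable_continuous_on_if) auto
  then have [measurable]: "(\<lambda>y. ereal (if enn2real y \<in> {0<..} then f (enn2real y) else 0)) \<in> borel_measurable borel"
    by measurable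
  have "utility_ext f = (\<lambda>y. if y = 0 then utility_ext f 0 else if y = \<infinity> then utility_ext f \<infinity>
      else ereal (if enn2real y \<in> {0<..} then f (enn2real y) else 0))"
    by (auto simp: utility_ext_def fun_eq_iff enn2real_eq_0_iff less_le)
  also have "\<dots> \<in> borel_measurable borel"
    by measurable
  finally show ?thesis .
qed

section \<open>The supergradient inequality in positive and negative parts\<close>

text \<open>Since \<open>ennreal\<close> sends negative reals to 0, \<open>ennreal x\<close> and
  \<open>ennreal (- x)\<close> are the positive and negative parts of \<open>x\<close>. Splitting
  \<open>u\<close>, \<open>v\<close> and \<open>b\<close> this way and moving every subtracted term
  across gives the claim.\<close>

lemma ennreal_parts_affine_le:
  fixes u v b t r :: real
  assumes le: "u \<le> v + b * (t - r)" and "0 \<le> t" "0 \<le> r"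
  shows "ennreal u + ennreal (- v) + ennreal (- b) * ennreal t + ennreal b * ennreal r
    \<le> ennreal v + ennreal (- u) + ennreal b * ennreal t + ennreal (- b) * ennreal r"
proof -
  have pos_eq: "max 0 x = x + max 0 (- x)" for x :: real
    by simp
  have "max 0 u + max 0 (- v) + max 0 (- b) * t + max 0 b * r
      \<le> max 0 v + max 0 (- u) + max 0 b * t + max 0 (- b) * r"
    using le unfolding pos_eq[of u] pos_eq[of v] pos_eq[of b] distrib_right right_diff_distrib
    by linarith
  moreover have "ennreal u + ennreal (- v) + ennreal (- b) * ennreal t + ennreal b * ennreal r
      = ennreal (max 0 u + max 0 (- v) + max 0 (- b) * t + max 0 b * r)"
    "ennreal v + ennreal (- u) + ennreal b * ennreal t + ennreal (- b) * ennreal r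
      = ennreal (max 0 v + max 0 (- u) + max 0 b * t + max 0 (- b) * r)"
    using assms(2,3) by (simp_all add: ennreal_mult)
  ultimately show ?thesis
    by (simp only: ennreal_leI)
qed

text \<open>When all values are finite this is the affine inequality above. In each infinite case
  compatible with the supergradient bound, the right-hand side contains an infinite summand, unless
  the slope is zero and the products with \<open>e\<close> and \<open>y\<close> vanish.\<close>

lemma utility_ext_supergradient_parts:
  assumes grad: "\<And>x y. 0 < x \<Longrightarrow> 0 < y \<Longrightarrow> f x \<le> f y + s y * (x - y)"
    and y: "0 < y" "y < \<infinity>"
  shows "e2ennreal (utility_ext f e) + e2ennreal (- utility_ext f y)
      + ennreal (- s (enn2real y)) * e + ennreal (s (enn2real y)) * y
    \<le> e2ennreal (utility_ext f y) + e2ennreal (- utility_ext f e)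
      + ennreal (s (enn2real y)) * e + ennreal (- s (enn2real y)) * y"
proof -
  obtain r where r: "0 < r" "y = ennreal r"
    using y by (cases y) auto
  have fy: "utility_ext f y = ereal (f r)"
    using r by (simp add: utility_ext_def)
  have le: "utility_ext f e \<le> ereal (f r) + ereal (s r) * (enn2ereal e - ereal r)"
    using grad r by (intro utility_ext_le_supergradient) auto
  show ?thesis
  proof (cases "utility_ext f e")
    case (real u)
    show ?thesis
    proof (cases e)
      case (real t)
      have "u \<le> f r + s r * (t - r)"
        using le \<open>utility_ext f e = ereal u\<close> real by (simp add: enn2ereal_ennreal)
      then have "ennreal u + ennreal (- f r) + ennreal (- s r) * ennreal t + ennreal (s r) * ennreal r
          \<le> ennreal (f r) + ennreal (- u) + ennreal (s r) * ennreal t + ennreal (- s r) * ennreal r"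
        using real r by (intro ennreal_parts_affine_le) auto
      then show ?thesis
        using r real \<open>utility_ext f e = ereal u\<close> fy by (simp add: e2ennreal_ereal)
    next
      case top
      consider "0 < s r" | "s r = 0" | "s r < 0" by linarith
      then show ?thesis
      proof cases
        case 1
        then show ?thesis using r top by (simp add: ennreal_mult_top)
      next
        case 2
        then have "u \<le> f r"
          using le real by (simp add: top flip: zero_ereal_def)
        then show ?thesis
          using r fy 2 real by (simp add: add_mono ennreal_leI)
      next
        case 3
        then show ?thesis using le real by (simp add: top)
      qed
    qed
  next
    case PInf
    \<comment> \<open>The supergradient bound equals \<infinity> only for an infinite argument and a
      positive slope.\<close>
    then have "e = \<infinity> \<and> 0 < s r"
      using le by (cases e; cases "s r" "0::real" rule: linorder_cases)
        (auto simp: enn2ereal_ennreal simp flip: zero_ereal_def)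
    then show ?thesis
      using r by (simp add: ennreal_mult_top)
  next
    case MInf
    then show ?thesis by simp
  qed
qed

section \<open>Conditional expectations and the conditional Jensen inequality\<close>

context sigma_finite_subalgebra
begin

text \<open>The shape matches each side of the supergradient inequality: a weighted part of the
  utility, a weighted copy of the variable, and a remainder measurable with respect to
  \<open>F\<close>.\<close>

lemma nn_cond_exp_affine:
  assumes [measurable]: "w \<in> borel_measurable F" "v \<in> borel_measurable F" "k \<in> borel_measurable F"
    "g \<in> borel_measurable M" "h \<in> borel_measurable M"
  shows "AE x in M. nn_cond_exp M F (\<lambda>x. w x * g x + (v x * h x + k x)) x
    = w x * nn_cond_exp M F g x + (v x * nn_cond_exp M F h x + k x)"
proof -
  have [measurable]: "w \<in> borel_measurable M" "v \<in> borel_measurable M" "k \<in> borel_measurable M"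
    using assms by (auto intro: measurable_from_subalg[OF subalg])
  have "AE x in M. nn_cond_exp M F (\<lambda>x. w x * g x) x + nn_cond_exp M F (\<lambda>x. v x * h x + k x) x
      = nn_cond_exp M F (\<lambda>x. w x * g x + (v x * h x + k x)) x"
    by (rule nn_cond_exp_sum) measurable
  moreover have "AE x in M. nn_cond_exp M F (\<lambda>x. v x * h x) x + nn_cond_exp M F k x
      = nn_cond_exp M F (\<lambda>x. v x * h x + k x) x"
    by (rule nn_cond_exp_sum) measurable
  moreover have "AE x in M. w x * nn_cond_exp M F g x = nn_cond_exp M F (\<lambda>x. w x * g x) x"
    by (rule nn_cond_exp_prod) measurable
  moreover have "AE x in M. v x * nn_cond_exp M F h x = nn_cond_exp M F (\<lambda>x. v x * h x) x"
    by (rule nn_cond_exp_prod) measurable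
  moreover have "AE x in M. k x = nn_cond_exp M F k x"
    by (rule nn_cond_exp_F_meas) measurable
  ultimately show ?thesis
    by eventually_elim simp
qed

text \<open>Locality: the indicator of an event of \<open>F\<close> can be pulled out of the
  conditional expectation.\<close>

lemma nn_cond_exp_cong_on:
  assumes [measurable]: "Measurable.pred F Q" "g \<in> borel_measurable M" "h \<in> borel_measurable M"
    and eq: "AE x in M. Q x \<longrightarrow> g x = h x"
  shows "AE x in M. Q x \<longrightarrow> nn_cond_exp M F g x = nn_cond_exp M F h x"
proof -
  define q :: "'a \<Rightarrow> ennreal" where "q x = (if Q x then 1 else 0)" for x
  have [measurable]: "q \<in> borel_measurable F"
    unfolding q_def by measurable
  then have [measurable]: "q \<in> borel_measurable M"
    by (rule measurable_from_subalg[OF subalg])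
  have "AE x in M. q x * g x = q x * h x"
    using eq by eventually_elim (simp add: q_def)
  then have "AE x in M. nn_cond_exp M F (\<lambda>x. q x * g x) x = nn_cond_exp M F (\<lambda>x. q x * h x) x"
    by (rule nn_cond_exp_cong) auto
  with nn_cond_exp_prod[of q g] nn_cond_exp_prod[of q h]
  show ?thesis
    by simp (auto simp: q_def elim!: eventually_elim2 elim: eventually_mono)
qed

text \<open>The event where the conditional expectation vanishes lies in \<open>F\<close>, so
  \<open>g\<close> has integral 0 over it.\<close>

lemma nn_cond_exp_eq_0_imp:
  assumes [measurable]: "g \<in> borel_measurable M"
  shows "AE x in M. nn_cond_exp M F g x = 0 \<longrightarrow> g x = 0"
proof -
  define q :: "'a \<Rightarrow> ennreal" where "q x = (if nn_cond_exp M F g x = 0 then 1 else 0)" for x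
  have [measurable]: "q \<in> borel_measurable F"
    unfolding q_def by measurable
  then have [measurable]: "q \<in> borel_measurable M"
    by (rule measurable_from_subalg[OF subalg])
  have "(\<integral>\<^sup>+ x. q x * g x \<partial>M) = (\<integral>\<^sup>+ x. q x * nn_cond_exp M F g x \<partial>M)"
    by (simp add: nn_cond_exp_intg)
  also have "\<dots> = 0"
    by (simp add: q_def if_distrib if_distribR cong: if_cong)
  finally have "AE x in M. q x * g x = 0"
    by (simp add: nn_integral_0_iff_AE)
  then show ?thesis
    by eventually_elim (simp add: q_def split: if_splits)
qed

lemma nn_cond_exp_utility_ext_Jensen:
  assumes f: "concave_on {0<..} f" and [measurable]: "X \<in> borel_measurable M"
  shows "AE x in M. nn_cond_exp M F (\<lambda>x. e2ennreal (utility_ext f (X x))) x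
        + e2ennreal (- utility_ext f (nn_cond_exp M F X x))
      \<le> e2ennreal (utility_ext f (nn_cond_exp M F X x))
        + nn_cond_exp M F (\<lambda>x. e2ennreal (- utility_ext f (X x))) x"
proof -
  obtain s where [measurable]: "s \<in> borel_measurable borel"
    and grad: "\<And>x y. 0 < x \<Longrightarrow> 0 < y \<Longrightarrow> f x \<le> f y + s y * (x - y)"
    using concave_measurable_supergradient[OF f] by blast
  note [measurable] = borel_measurable_utility_ext[OF f]
  define p where "p e = e2ennreal (utility_ext f e)" for e
  define n where "n e = e2ennreal (- utility_ext f e)" for e
  have [measurable]: "p \<in> borel_measurable borel" "n \<in> borel_measurable borel"
    unfolding p_def n_def by measurable
  let ?C = "nn_cond_exp M F"
  define Y where "Y = ?C X"
  have [measurable]: "Y \<in> borel_measurable F"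
    by (simp add: Y_def)
  then have [measurable]: "Y \<in> borel_measurable M"
    by (rule measurable_from_subalg[OF subalg])
  have parts: "p e + n y + ennreal (- s (enn2real y)) * e + ennreal (s (enn2real y)) * y
    \<le> p y + n e + ennreal (s (enn2real y)) * e + ennreal (- s (enn2real y)) * y"
    if "0 < y" "y < \<infinity>" for e y
    unfolding p_def n_def using utility_ext_supergradient_parts[OF grad that] .

  have inner: "AE x in M. 0 < Y x \<and> Y x < \<infinity> \<longrightarrow> ?C (\<lambda>x. p (X x)) x + n (Y x) \<le> p (Y x) + ?C (\<lambda>x. n (X x)) x"
  proof -
    \<comment> \<open>\<open>q\<close> localises to an event of \<open>F\<close>. Off it all weights
      are 0 and both sides vanish, because 0 times \<infinity> is 0 in \<open>ennreal\<close>; the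
      inequality to be conditioned thus holds everywhere. \<open>u\<close> and \<open>v\<close> are
      the localised positive and negative parts of the slope at \<open>Y\<close>.\<close>
    define q :: "'a \<Rightarrow> ennreal" where "q x = (if 0 < Y x \<and> Y x < \<infinity> then 1 else 0)" for x
    define u where "u x = q x * ennreal (s (enn2real (Y x)))" for x
    define v where "v x = q x * ennreal (- s (enn2real (Y x)))" for x
    have [measurable]: "q \<in> borel_measurable F"
      unfolding q_def by measurable
    have [measurable]: "u \<in> borel_measurable F" "v \<in> borel_measurable F"
      unfolding u_def v_def by measurable
    have [measurable]: "q \<in> borel_measurable M" "u \<in> borel_measurable M" "v \<in> borel_measurable M"
      by (auto intro: measurable_from_subalg[OF subalg])
    have "AE x in M. ?C (\<lambda>x. q x * p (X x) + (v x * X x + (q x * n (Y x) + u x * Y x))) x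
        \<le> ?C (\<lambda>x. q x * n (X x) + (u x * X x + (q x * p (Y x) + v x * Y x))) x"
    proof (rule nn_cond_exp_mono)
      show "AE x in M. q x * p (X x) + (v x * X x + (q x * n (Y x) + u x * Y x))
          \<le> q x * n (X x) + (u x * X x + (q x * p (Y x) + v x * Y x))"
        using parts by (intro AE_I2) (auto simp: q_def u_def v_def ac_simps)
    qed measurable
    moreover have "AE x in M. ?C (\<lambda>x. q x * p (X x) + (v x * X x + (q x * n (Y x) + u x * Y x))) x
        = q x * ?C (\<lambda>x. p (X x)) x + (v x * Y x + (q x * n (Y x) + u x * Y x))"
      \<comment> \<open>\<open>Y\<close> is unfolded so that the rule can recognise the conditional
        expectation of \<open>X\<close>, and folded back for the measurability goals.\<close>
      unfolding Y_def by (rule nn_cond_exp_affine) (unfold Y_def[symmetric], measurable)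
    moreover have "AE x in M. ?C (\<lambda>x. q x * n (X x) + (u x * X x + (q x * p (Y x) + v x * Y x))) x
        = q x * ?C (\<lambda>x. n (X x)) x + (u x * Y x + (q x * p (Y x) + v x * Y x))"
      unfolding Y_def by (rule nn_cond_exp_affine) (unfold Y_def[symmetric], measurable)
    ultimately show ?thesis
    proof eventually_elim
      case (elim x)
      show ?case
      proof
        assume Y: "0 < Y x \<and> Y x < \<infinity>"
        \<comment> \<open>Conditioning has turned \<open>X\<close> into \<open>Y\<close>, so both
          sides contain \<open>?k\<close>; its finiteness is what permits cancellation in
          \<open>ennreal\<close>.\<close>
        let ?k = "u x * Y x + v x * Y x"
        have "?k + (?C (\<lambda>x. p (X x)) x + n (Y x)) \<le> ?k + (p (Y x) + ?C (\<lambda>x. n (X x)) x)"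
          using elim Y by (simp add: q_def ac_simps)
        moreover have "?k \<noteq> \<top>"
          using Y by (auto simp: u_def v_def q_def ennreal_mult_eq_top_iff)
        ultimately show "?C (\<lambda>x. p (X x)) x + n (Y x) \<le> p (Y x) + ?C (\<lambda>x. n (X x)) x"
          by (simp add: ennreal_add_left_cancel_le)
      qed
    qed
  qed

  have const: "AE x in M. c = ?C (\<lambda>x. c) x" for c
    by (rule nn_cond_exp_F_meas) simp

  have "AE x in M. Y x = 0 \<longrightarrow> X x = 0"
    unfolding Y_def by (rule nn_cond_exp_eq_0_imp) simp
  \<comment> \<open>Where \<open>Y\<close> vanishes, \<open>g (X x)\<close> is almost surely the
    constant \<open>g 0\<close>, and locality applies. For \<open>p\<close> and \<open>n\<close>
    both sides of the Jensen inequality become \<open>p 0 + n 0\<close>.\<close>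
  then have at_0: "AE x in M. Y x = 0 \<longrightarrow> ?C (\<lambda>x. g (X x)) x = g 0"
    if [measurable]: "g \<in> borel_measurable borel" for g :: "ennreal \<Rightarrow> ennreal"
  proof -
    have "AE x in M. Y x = 0 \<longrightarrow> ?C (\<lambda>x. g (X x)) x = ?C (\<lambda>x. g 0) x"
      using \<open>AE x in M. Y x = 0 \<longrightarrow> X x = 0\<close>
      by (intro nn_cond_exp_cong_on) (auto elim: eventually_mono)
    with const[of "g 0"] show ?thesis
      by eventually_elim simp
  qed
  from at_0[of p] at_0[of n]
  have zero: "AE x in M. Y x = 0 \<longrightarrow> ?C (\<lambda>x. p (X x)) x + n (Y x) \<le> p (Y x) + ?C (\<lambda>x. n (X x)) x"
    by auto

  have infinite: "AE x in M. Y x = \<infinity> \<longrightarrow> ?C (\<lambda>x. p (X x)) x + n (Y x) \<le> p (Y x) + ?C (\<lambda>x. n (X x)) x"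
  proof (cases "\<exists>y>0. s y < 0")
    case True
    then obtain y where y: "0 < y" "s y < 0" by blast
    \<comment> \<open>\<open>k\<close> collects the finite terms of the supergradient inequality
      based at \<open>y\<close>. Conditioning \<open>le\<close> bounds \<open>- s y\<close> times
      \<open>Y\<close> by the conditional expectation of \<open>n (X x)\<close> plus
      \<open>k\<close>; where \<open>Y\<close> is infinite, that conditional expectation must
      therefore be infinite.\<close>
    define k where "k = p (ennreal y) + ennreal (- s y) * ennreal y"
    have "utility_ext f (ennreal y) = ereal (f y)"
      using y by (simp add: utility_ext_def)
    then have k: "k \<noteq> \<top>"
      by (simp add: k_def p_def e2ennreal_ereal ennreal_mult_eq_top_iff)
    have le: "ennreal (- s y) * e \<le> n e + k" for e
    proof -
      have "ennreal (- s y) * e \<le> p e + n (ennreal y) + ennreal (- s y) * e"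
        by simp
      also have "\<dots> \<le> n e + k"
        using parts[of "ennreal y" e] y by (simp add: k_def ennreal_neg ac_simps)
      finally show ?thesis .
    qed
    have "AE x in M. ?C (\<lambda>x. ennreal (- s y) * X x) x \<le> ?C (\<lambda>x. n (X x) + k) x"
      by (rule nn_cond_exp_mono) (auto simp: le)
    moreover have "AE x in M. ennreal (- s y) * Y x = ?C (\<lambda>x. ennreal (- s y) * X x) x"
      unfolding Y_def by (rule nn_cond_exp_prod) auto
    moreover have "AE x in M. ?C (\<lambda>x. n (X x)) x + ?C (\<lambda>x. k) x = ?C (\<lambda>x. n (X x) + k) x"
      by (rule nn_cond_exp_sum) auto
    ultimately show ?thesis
      using const[of k]
    proof eventually_elim
      case (elim x)
      then have "ennreal (- s y) * Y x \<le> ?C (\<lambda>x. n (X x)) x + k"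
        by simp
      then show ?case
        using y k by (auto simp: ennreal_mult_top top_unique)
    qed
  next
    case False
    then have nonneg: "0 \<le> s y" if "0 < y" for y
      using that by (meson not_less)
    have le: "utility_ext f e \<le> utility_ext f \<infinity>" for e
      using utility_ext_mono_le_top[of f s, OF grad nonneg] .
    \<comment> \<open>With no negative slope, \<open>p\<close> is largest and \<open>n\<close>
      smallest at \<infinity>, and constants are their own conditional expectations.\<close>
    have "AE x in M. ?C (\<lambda>x. p (X x)) x \<le> ?C (\<lambda>x. p \<infinity>) x"
      by (rule nn_cond_exp_mono) (auto simp: p_def intro!: e2ennreal_mono le[simplified])
    moreover have "AE x in M. ?C (\<lambda>x. n \<infinity>) x \<le> ?C (\<lambda>x. n (X x)) x"
      by (rule nn_cond_exp_mono) (auto simp: n_def intro!: e2ennreal_mono le[simplified])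
    ultimately show ?thesis
      using const[of "p \<infinity>"] const[of "n \<infinity>"]
      by eventually_elim (auto intro!: add_mono)
  qed

  show ?thesis
    using inner zero infinite
    unfolding p_def[symmetric] n_def[symmetric] Y_def[symmetric]
    by eventually_elim (metis infinity_ennreal_def not_gr_zero top.not_eq_extremum)
qed

text \<open>The conditional inequality is integrated; all terms are nonnegative, so additivity and
  the tower property apply even to infinite integrals.\<close>

lemma expectation_utility_ext_nn_cond_exp:
  assumes f: "concave_on {0<..} f" and [measurable]: "X \<in> borel_measurable M"
  shows "expectation_pos M (\<lambda>x. utility_ext f (X x))
      + expectation_neg M (\<lambda>x. utility_ext f (nn_cond_exp M F X x))
    \<le> expectation_pos M (\<lambda>x. utility_ext f (nn_cond_exp M F X x))
      + expectation_neg M (\<lambda>x. utility_ext f (X x))"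
proof -
  note [measurable] = borel_measurable_utility_ext[OF f]
  have tower: "(\<integral>\<^sup>+ x. nn_cond_exp M F g x \<partial>M) = (\<integral>\<^sup>+ x. g x \<partial>M)"
    if "g \<in> borel_measurable M" for g
    using nn_cond_exp_intg[of "\<lambda>_. 1" g] that by simp
  show ?thesis
    using nn_integral_mono_AE[OF nn_cond_exp_utility_ext_Jensen[OF assms]]
    by (simp add: expectation_pos_def expectation_neg_def nn_integral_add tower)
qed

end

section \<open>Extended expectations and common versions of conditional expectations\<close>

lemma ext_expectation_le:
  assumes le: "expectation_pos M Y + expectation_neg M Z \<le> expectation_pos M Z + expectation_neg M Y"
    and "expectation_well_defined M Y" "expectation_well_defined M Z"
  shows "ext_expectation M Y \<le> ext_expectation M Z"
proof -
  \<comment> \<open>The case \<open>a = b = \<infinity>\<close> has to be excluded: the sums would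
    then compare trivially, while \<infinity> - \<infinity> is \<infinity> in
    \<open>ereal\<close>.\<close>
  have real: "enn2ereal a - enn2ereal b \<le> enn2ereal c - enn2ereal d"
    if "a + d \<le> c + b" "a < \<infinity> \<or> b < \<infinity>" "c < \<infinity> \<or> d < \<infinity>" for a b c d
    using that by (cases a; cases b; cases c; cases d)
      (auto simp: enn2ereal_ennreal top_unique simp flip: ennreal_plus)
  show ?thesis
    using assms unfolding ext_expectation_def expectation_well_defined_def by (intro real)
qed

lemma (in sigma_finite_subalgebra) ext_cond_exp_nonneg:
  assumes [measurable]: "X \<in> borel_measurable M"
  shows "AE x in M. ext_cond_exp M F (\<lambda>x. enn2ereal (X x)) x = enn2ereal (nn_cond_exp M F X x)"
proof -
  have "AE x in M. 0 = nn_cond_exp M F (\<lambda>x. 0) x"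
    by (rule nn_cond_exp_F_meas) simp
  then show ?thesis
    by eventually_elim (simp add: ext_cond_exp_def e2ennreal_neg zero_ennreal.rep_eq)
qed

lemma expectation_well_defined_nonneg: "expectation_well_defined M (\<lambda>x. enn2ereal (X x))"
proof -
  have "e2ennreal (- enn2ereal a) = 0" for a
    by (rule e2ennreal_neg) simp
  then show ?thesis
    by (simp add: expectation_well_defined_def expectation_neg_def)
qed

lemma sigma_finite_subalgebra_vimage:
  assumes "prob_space Q" "sets Q = sets M" "S \<in> measurable M N"
  shows "sigma_finite_subalgebra Q (vimage_algebra (space M) S N)"
proof -
  interpret prob_space Q by fact
  have "space Q = space M"
    using assms(2) by (rule sets_eq_imp_space_eq)
  moreover have "sets (vimage_algebra (space M) S N) \<subseteq> sets M"
    using assms(3) by (intro sets_image_in_sets) auto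
  ultimately have "subalgebra Q (vimage_algebra (space M) S N)"
    by (simp add: subalgebra_def assms(2))
  then have "finite_measure_subalgebra Q (vimage_algebra (space M) S N)"
    by unfold_locales
  then show ?thesis
    by (rule finite_measure_subalgebra_is_sigma_finite)
qed

text \<open>This links sufficiency to the Jensen inequality: for nonnegative \<open>X\<close> the
  expectation is well-defined under every \<open>P \<theta>\<close>, and the negative part
  contributes 0 to the conditional expectation.\<close>

lemma common_cond_exp_nonneg:
  assumes "common_cond_exp M P \<Theta> N S (\<lambda>x. enn2ereal (X x)) H"
    and model: "statistical_model M P \<Theta>" and S: "S \<in> measurable M N"
    and X: "X \<in> borel_measurable M" and \<theta>: "\<theta> \<in> \<Theta>"
  shows "AE x in P \<theta>. H x = enn2ereal (nn_cond_exp (P \<theta>) (vimage_algebra (space M) S N) X x)"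
proof -
  have Q: "prob_space (P \<theta>)" "sets (P \<theta>) = sets M"
    using model \<theta> by (auto simp: statistical_model_def)
  interpret sigma_finite_subalgebra "P \<theta>" "vimage_algebra (space M) S N"
    using Q S by (rule sigma_finite_subalgebra_vimage)
  have space: "space (P \<theta>) = space M"
    using Q(2) by (rule sets_eq_imp_space_eq)
  obtain g where g: "\<forall>x\<in>space M. H x = g (S x)"
    "AE x in P \<theta>. ext_cond_exp (P \<theta>) (vimage_algebra (space M) S N) (\<lambda>x. enn2ereal (X x)) x = g (S x)"
    using assms(1) \<theta> expectation_well_defined_nonneg unfolding common_cond_exp_def by blast
  have "X \<in> borel_measurable (P \<theta>)"
    using X Q by (simp cong: measurable_cong_sets)
  from ext_cond_exp_nonneg[OF this] g(2) AE_space show ?thesis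
    by eventually_elim (use g(1) space in auto)
qed

theorem theorem2p1:
  fixes M :: "'a measure" and P :: "'i \<Rightarrow> 'a measure"
    and \<Theta> \<Theta>0 \<Theta>1 :: "'i set"
    and N :: "'b measure" and S :: "'a \<Rightarrow> 'b"
    and E :: "'a \<Rightarrow> ennreal"
  assumes "statistical_model M P \<Theta>"
    and "\<Theta> = \<Theta>0 \<union> \<Theta>1" and "\<Theta>0 \<inter> \<Theta>1 = {}"
    and "sufficient_statistic M P \<Theta> N S"
    and "e_variable M P \<Theta>0 E"
  shows "(\<exists>G :: 'a \<Rightarrow> ennreal.
            common_cond_exp M P \<Theta> N S (\<lambda>x. enn2ereal (E x)) (\<lambda>x. enn2ereal (G x))) \<and>
         (\<forall>G :: 'a \<Rightarrow> ennreal.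
            common_cond_exp M P \<Theta> N S (\<lambda>x. enn2ereal (E x)) (\<lambda>x. enn2ereal (G x)) \<longrightarrow>
              e_variable M P \<Theta>0 G \<and>
              (\<forall>f. concave_on {0<..} f \<longrightarrow>
                (\<forall>\<theta>\<in>\<Theta>.
                   expectation_well_defined (P \<theta>) (\<lambda>x. utility_ext f (G x)) \<longrightarrow>
                   expectation_well_defined (P \<theta>) (\<lambda>x. utility_ext f (E x)) \<longrightarrow>
                   ext_expectation (P \<theta>) (\<lambda>x. utility_ext f (G x))
                     \<ge> ext_expectation (P \<theta>) (\<lambda>x. utility_ext f (E x)))))"
proof -
  note model = \<open>statistical_model M P \<Theta>\<close>
  have S [measurable]: "S \<in> measurable M N"
    using assms by (simp add: sufficient_statistic_def)
  have E [measurable]: "E \<in> borel_measurable M"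
    using assms by (simp add: e_variable_def)
  let ?F = "vimage_algebra (space M) S N"
  have sub: "sigma_finite_subalgebra (P \<theta>) ?F" "sets (P \<theta>) = sets M" if "\<theta> \<in> \<Theta>" for \<theta>
    using model that S by (auto simp: statistical_model_def intro: sigma_finite_subalgebra_vimage)
  show ?thesis
  proof (intro conjI allI impI ballI)
    obtain H where H: "common_cond_exp M P \<Theta> N S (\<lambda>x. enn2ereal (E x)) H"
      using \<open>sufficient_statistic M P \<Theta> N S\<close> measurable_compose[OF E measurable_enn2ereal]
      by (metis sufficient_statistic_def)
    then obtain g where [measurable]: "g \<in> borel_measurable N" and g: "\<forall>x\<in>space M. H x = g (S x)"
      unfolding common_cond_exp_def by blast
    \<comment> \<open>\<open>H\<close> has values in \<open>ereal\<close> and may be negative on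
      null sets. Truncation by \<open>e2ennreal\<close> yields the nonnegative witness; it changes
      nothing almost surely, since \<open>H\<close> agrees with a nonnegative conditional
      expectation under each \<open>P \<theta>\<close>.\<close>
    have "AE x in P \<theta>. ext_cond_exp (P \<theta>) ?F (\<lambda>x. enn2ereal (E x)) x = enn2ereal (e2ennreal (g (S x)))"
      if \<theta>: "\<theta> \<in> \<Theta>" for \<theta>
    proof -
      interpret sigma_finite_subalgebra "P \<theta>" ?F using sub \<theta> by blast
      have "E \<in> borel_measurable (P \<theta>)"
        using E sub[OF \<theta>] by (simp cong: measurable_cong_sets)
      from ext_cond_exp_nonneg[OF this] common_cond_exp_nonneg[OF H model S E \<theta>] AE_space
      show ?thesis
        by eventually_elim (use g sets_eq_imp_space_eq[OF sub(2)[OF \<theta>]] in auto)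
    qed
    then show "\<exists>G. common_cond_exp M P \<Theta> N S (\<lambda>x. enn2ereal (E x)) (\<lambda>x. enn2ereal (G x))"
      unfolding common_cond_exp_def
      by (intro exI[of _ "\<lambda>x. e2ennreal (g (S x))"] bexI[of _ "\<lambda>y. enn2ereal (e2ennreal (g y))"]) auto
  next
    fix G
    assume G: "common_cond_exp M P \<Theta> N S (\<lambda>x. enn2ereal (E x)) (\<lambda>x. enn2ereal (G x))"
    have eq: "AE x in P \<theta>. G x = nn_cond_exp (P \<theta>) ?F E x" if "\<theta> \<in> \<Theta>" for \<theta>
      using common_cond_exp_nonneg[OF G model S E that] by (simp add: enn2ereal_inject)
    obtain g where [measurable]: "g \<in> borel_measurable N" and g: "\<forall>x\<in>space M. enn2ereal (G x) = g (S x)"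
      using G unfolding common_cond_exp_def by blast
    \<comment> \<open>\<open>G\<close> is an arbitrary common version, so its measurability is
      recovered from the factorisation through \<open>S\<close>.\<close>
    have "(\<lambda>x. e2ennreal (g (S x))) \<in> borel_measurable M"
      by measurable
    then have "G \<in> borel_measurable M"
      by (rule measurable_cong[THEN iffD1, rotated]) (metis g e2ennreal_enn2ereal)
    moreover have "(\<integral>\<^sup>+ x. G x \<partial>P \<theta>) \<le> 1" if \<theta>: "\<theta> \<in> \<Theta>0" for \<theta>
    proof -
      have "\<theta> \<in> \<Theta>" using \<theta> assms(2) by simp
      interpret sigma_finite_subalgebra "P \<theta>" ?F using sub \<open>\<theta> \<in> \<Theta>\<close> by blast
      \<comment> \<open>Tower property with the constant 1 as test function: \<open>G\<close> and
        \<open>E\<close> have the same mean under \<open>P \<theta>\<close>.\<close>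
      have "(\<integral>\<^sup>+ x. G x \<partial>P \<theta>) = (\<integral>\<^sup>+ x. 1 * nn_cond_exp (P \<theta>) ?F E x \<partial>P \<theta>)"
        using eq[OF \<open>\<theta> \<in> \<Theta>\<close>] by (intro nn_integral_cong_AE) simp
      also have "\<dots> = (\<integral>\<^sup>+ x. 1 * E x \<partial>P \<theta>)"
        using E sub[OF \<open>\<theta> \<in> \<Theta>\<close>] by (intro nn_cond_exp_intg) (simp_all cong: measurable_cong_sets)
      finally show ?thesis
        using assms(5) \<theta> by (simp add: e_variable_def)
    qed
    ultimately show "e_variable M P \<Theta>0 G"
      by (simp add: e_variable_def)
    fix f \<theta>
    assume f: "concave_on {0<..} f" and \<theta>: "\<theta> \<in> \<Theta>"
      and wd: "expectation_well_defined (P \<theta>) (\<lambda>x. utility_ext f (G x))"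
        "expectation_well_defined (P \<theta>) (\<lambda>x. utility_ext f (E x))"
    interpret sigma_finite_subalgebra "P \<theta>" ?F using sub \<theta> by blast
    have "E \<in> borel_measurable (P \<theta>)"
      using E sub[OF \<theta>] by (simp cong: measurable_cong_sets)
    note expectation_utility_ext_nn_cond_exp[OF f this]
    moreover have "expectation_pos (P \<theta>) (\<lambda>x. utility_ext f (nn_cond_exp (P \<theta>) ?F E x))
        = expectation_pos (P \<theta>) (\<lambda>x. utility_ext f (G x))"
      "expectation_neg (P \<theta>) (\<lambda>x. utility_ext f (nn_cond_exp (P \<theta>) ?F E x))
        = expectation_neg (P \<theta>) (\<lambda>x. utility_ext f (G x))"
      using eq[OF \<theta>] unfolding expectation_pos_def expectation_neg_def
      by (auto intro!: nn_integral_cong_AE elim: eventually_mono)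
    ultimately show "ext_expectation (P \<theta>) (\<lambda>x. utility_ext f (E x))
        \<le> ext_expectation (P \<theta>) (\<lambda>x. utility_ext f (G x))"
      using wd by (intro ext_expectation_le) simp_all
  qed
qed

end
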